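(* Let $(J,\mathcal{A})$ be a standard Borel space, let $v:J\times J\to\mathbb{R}_+$ be a bounded measurable function, let $c\in\mathbb{R}$, and let $\varphi,\psi$ be finite nonnegative measures on $\mathcal{A}\times\mathcal{A}$ with $\varphi\le\psi$. There is a circulation $\alpha$ with $\varphi\le\alpha\le\psi$ and $\alpha(v)=c$ if and only if for every potential $F$ the following three conditions hold: \[ \psi(|F+v|_+)\ge\varphi(|F+v|_-)+c,\qquad \psi(|F-v|_+)\ge\varphi(|F-v|_-)-c,\qquad \psi(|F|_+)\ge\varphi(|F|_-). \]
   Context: A circulation is a finite signed measure $\alpha$ on $\mathcal{A}\times\mathcal{A}$ with $\alpha(A\times J)=\alpha(J\times A)$ for all $A\in\mathcal{A}$. A potential is a measurable function $F:J\times J\to\mathbb{R}$ of the form $F(x,y)=f(x)-f(y)$ for some measurable $f:J\to\mathbb{R}$. For a measure $\mu$ and function $g$, $\mu(g)=\int g\,d\mu$. For a real $t$, $|t|_+=\max(t,0)$ and $|t|_-=\max(-t,0)$, applied pointwise to functions. Inequalities between measures are setwise. *)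

theory Defs
  imports "HOL-Analysis.Analysis"
begin

text \<open>A measurable space is given by the \<open>space\<close> and \<open>sets\<close> of a value of type \<open>'a measure\<close>;
  its \<open>emeasure\<close> plays no role in \<open>standard_borel\<close>, \<open>finite_signed_measure\<close>,
  \<open>circulation\<close> or \<open>potential\<close>.\<close>

definition standard_borel :: "'a measure \<Rightarrow> bool" where
  "standard_borel M \<longleftrightarrow>
     (\<exists>X. completely_metrizable_space X \<and> separable_space X \<and>
          topspace X = space M \<and> sets M = sigma_sets (topspace X) {U. openin X U})"

text \<open>Values of \<open>\<alpha>\<close> outside \<open>sets M\<close> are irrelevant.\<close>

definition finite_signed_measure :: "'a measure \<Rightarrow> ('a set \<Rightarrow> real) \<Rightarrow> bool" where
  "finite_signed_measure M \<alpha> \<longleftrightarrow>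
     \<alpha> {} = 0 \<and>
     (\<forall>A :: nat \<Rightarrow> 'a set. range A \<subseteq> sets M \<longrightarrow> disjoint_family A \<longrightarrow>
        (\<lambda>i. \<alpha> (A i)) sums \<alpha> (\<Union>i. A i))"

text \<open>The positive part of the Jordan decomposition,
  \<open>A \<mapsto> sup {\<alpha> B | B \<in> sets M, B \<subseteq> A}\<close>; the negative part is the positive part of \<open>- \<alpha>\<close>.
  Taking \<open>B = {}\<close> shows that the truncation performed by \<open>ennreal\<close> does not affect the supremum.\<close>

definition positive_variation :: "'a measure \<Rightarrow> ('a set \<Rightarrow> real) \<Rightarrow> 'a measure" where
  "positive_variation M \<alpha> =
     measure_of (space M) (sets M) (\<lambda>A. SUP B\<in>{B \<in> sets M. B \<subseteq> A}. ennreal (\<alpha> B))"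

definition signed_integral :: "'a measure \<Rightarrow> ('a set \<Rightarrow> real) \<Rightarrow> ('a \<Rightarrow> real) \<Rightarrow> real" where
  "signed_integral M \<alpha> g =
     integral\<^sup>L (positive_variation M \<alpha>) g - integral\<^sup>L (positive_variation M (\<lambda>A. - \<alpha> A)) g"

definition circulation :: "'a measure \<Rightarrow> (('a \<times> 'a) set \<Rightarrow> real) \<Rightarrow> bool" where
  "circulation J \<alpha> \<longleftrightarrow>
     finite_signed_measure (J \<Otimes>\<^sub>M J) \<alpha> \<and>
     (\<forall>A\<in>sets J. \<alpha> (A \<times> space J) = \<alpha> (space J \<times> A))"

definition potential :: "'a measure \<Rightarrow> ('a \<times> 'a \<Rightarrow> real) \<Rightarrow> bool" where
  "potential J F \<longleftrightarrow>
     F \<in> borel_measurable (J \<Otimes>\<^sub>M J) \<and>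
     (\<exists>f\<in>borel_measurable J. \<forall>x\<in>space J. \<forall>y\<in>space J. F (x, y) = f x - f y)"

definition pos_part :: "real \<Rightarrow> real" where
  "pos_part t = max t 0"

definition neg_part :: "real \<Rightarrow> real" where
  "neg_part t = max (- t) 0"

text \<open>Potentials need not be bounded, so the integrals of \<open>|F \<plusminus> v|\<^sub>+\<close> and \<open>|F \<plusminus> v|\<^sub>-\<close> may be infinite.
  They are taken in the extended reals, because a (possibly negative) real \<open>c\<close> is added to them.\<close>

definition ext_integral :: "'a measure \<Rightarrow> ('a \<Rightarrow> real) \<Rightarrow> ereal" where
  "ext_integral \<mu> g = enn2ereal (\<integral>\<^sup>+ p. ennreal (g p) \<partial>\<mu>)"

end

theory Submission
  imports Defs
begin

text \<open>Measures between \<open>\<phi>\<close> and \<open>\<psi>\<close> are the linear functionals on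
  \<open>\<psi>\<close>-integrable functions that lie between integration against \<open>\<phi>\<close> and against \<open>\<psi>\<close> on
  nonnegative functions; these form a convex set that is compact for pointwise convergence.
  The supremum of such functionals at \<open>g\<close> is \<open>\<psi>(|g|\<^sub>+) - \<phi>(|g|\<^sub>-)\<close>, so the three conditions say
  that no single linear combination \<open>F + s v\<close> of the constraints is violated. A least squares
  argument then solves any finite set of constraints, and compactness solves all of them.
  Conversely, a nonnegative circulation integrates every potential with integrable positive part to \<open>0\<close>.\<close>

section \<open>Compactness and solvability of systems of linear constraints\<close>

text \<open>Tychonoff's theorem: the set is a product of the compact intervals from
  \<open>- B g\<close> to \<open>B g\<close>, and the topology of the function type is the product
  topology, that is, pointwise convergence.\<close>

lemma compact_pointwise_bounded:
  fixes B :: "'b \<Rightarrow> real"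
  shows "compact {k. \<forall>g. \<bar>k g\<bar> \<le> B g}"
proof -
  have "compactin (product_topology (\<lambda>_. euclidean) UNIV) (PiE UNIV (\<lambda>g. {- B g .. B g}))"
    by (subst compactin_PiE) (simp add: compactin_euclidean_iff)
  moreover have "PiE UNIV (\<lambda>g. {- B g .. B g}) = {k. \<forall>g. \<bar>k g\<bar> \<le> B g}"
    by (auto simp: PiE_UNIV_domain abs_le_iff Pi_iff) (smt (verit))+
  ultimately show ?thesis
    by (simp add: euclidean_product_topology compactin_euclidean_iff)
qed

text \<open>The minimiser of the sum of squared errors is a solution: otherwise \<open>dual\<close>, with \<open>t\<close> the
  negated errors, yields a direction in which the sum decreases.\<close>

lemma finite_constraints_solvable:
  fixes C :: "('b \<Rightarrow> real) set" and I :: "('b \<times> real) set"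
  assumes C: "compact C" "C \<noteq> {}"
    and convex: "\<And>k l u. k \<in> C \<Longrightarrow> l \<in> C \<Longrightarrow> 0 \<le> u \<Longrightarrow> u \<le> 1 \<Longrightarrow>
      (\<lambda>g. (1 - u) * k g + u * l g) \<in> C"
    and I: "finite I"
    and dual: "\<And>t. \<exists>k\<in>C. (\<Sum>i\<in>I. t i * (k (fst i) - snd i)) \<ge> 0"
  shows "\<exists>k\<in>C. \<forall>i\<in>I. k (fst i) = snd i"
proof -
  define e :: "('b \<Rightarrow> real) \<Rightarrow> 'b \<times> real \<Rightarrow> real" where "e k i = k (fst i) - snd i" for k i
  define q where "q k = (\<Sum>i\<in>I. (e k i)\<^sup>2)" for k
  have "continuous_on C q"
    unfolding q_def e_def
    by (intro continuous_intros continuous_on_subset[OF continuous_on_product_coordinates]) auto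
  then obtain k where k: "k \<in> C" "\<And>l. l \<in> C \<Longrightarrow> q k \<le> q l"
    using continuous_attains_inf[OF C] by blast
  obtain l where l: "l \<in> C" "(\<Sum>i\<in>I. - e k i * e l i) \<ge> 0"
    using dual[of "\<lambda>i. - e k i"] by (auto simp: e_def)
  define R where "R = (\<Sum>i\<in>I. e k i * e l i)"
  have R: "R \<le> 0" using l(2) by (simp add: R_def sum_negf)
  have q_nonneg: "q m \<ge> 0" for m by (simp add: q_def sum_nonneg)
  have "q k = 0"
  proof (rule ccontr)
    assume "q k \<noteq> 0"
    then have pos: "q k > 0" using q_nonneg[of k] by simp
    \<comment> \<open>This \<open>u\<close> minimises
      \<open>(1 - u)\<^sup>2 * q k + u\<^sup>2 * q l\<close>, the bound that remains without the
      cross term; for \<open>q k > 0\<close> the minimum is less than \<open>q k\<close>.\<close>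
    define u where "u = q k / (q k + q l)"
    have u: "0 < u" "u \<le> 1" using pos q_nonneg[of l] by (auto simp: u_def field_simps)
    define m where "m = (\<lambda>g. (1 - u) * k g + u * l g)"
    have "m \<in> C" using convex[of k l u] k l u by (simp add: m_def)
    then have "q k \<le> q m" by (rule k)
    also have "q m = (\<Sum>i\<in>I. (1-u)\<^sup>2 * (e k i)\<^sup>2 + 2*u*(1-u) * (e k i * e l i) + u\<^sup>2 * (e l i)\<^sup>2)"
      unfolding q_def
      by (rule sum.cong) (auto simp: e_def m_def power2_eq_square algebra_simps)
    also have "\<dots> = (1-u)\<^sup>2 * q k + 2*u*(1-u) * R + u\<^sup>2 * q l"
      by (simp add: sum.distrib sum_distrib_left q_def R_def)
    also have "\<dots> \<le> (1-u)\<^sup>2 * q k + u\<^sup>2 * q l"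
      using u R by (simp add: mult_nonneg_nonpos)
    also have "\<dots> = q k - 2 * u * q k + u * (u * (q k + q l))"
      by (simp add: power2_eq_square algebra_simps)
    also have "u * (q k + q l) = q k" using pos q_nonneg[of l] by (simp add: u_def)
    finally have "u * q k \<le> 0" by simp
    then show False using u pos by (simp add: mult_le_0_iff)
  qed
  then have "\<forall>i\<in>I. e k i = 0"
    using I by (simp add: q_def sum_nonneg_eq_0_iff)
  then show ?thesis using k by (auto simp: e_def)
qed

text \<open>\<open>W\<close> holds the constraints \<open>k g = d\<close> as pairs \<open>(g, d)\<close>; being a subspace, it turns the weighted
  sums of the finite case into single constraints.\<close>

lemma constraints_solvable:
  fixes C :: "(('b \<Rightarrow> real) \<Rightarrow> real) set" and W :: "(('b \<Rightarrow> real) \<times> real) set"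
  assumes C: "compact C" "C \<noteq> {}"
    and convex: "\<And>k l u. k \<in> C \<Longrightarrow> l \<in> C \<Longrightarrow> 0 \<le> u \<Longrightarrow> u \<le> 1 \<Longrightarrow>
      (\<lambda>g. (1 - u) * k g + u * l g) \<in> C"
    and W_zero: "(\<lambda>_. 0, 0) \<in> W"
    and W_lincomb: "\<And>f c g d t. (f, c) \<in> W \<Longrightarrow> (g, d) \<in> W \<Longrightarrow> (\<lambda>x. t * f x + g x, t * c + d) \<in> W"
    and linear: "\<And>k f c g d t. k \<in> C \<Longrightarrow> (f, c) \<in> W \<Longrightarrow> (g, d) \<in> W \<Longrightarrow>
      k (\<lambda>x. t * f x + g x) = t * k f + k g"
    and dual: "\<And>g d. (g, d) \<in> W \<Longrightarrow> \<exists>k\<in>C. k g \<ge> d"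
  shows "\<exists>k\<in>C. \<forall>(g, d)\<in>W. k g = d"
proof -
  have k_zero: "k (\<lambda>_. 0) = 0" if "k \<in> C" for k
    using linear[OF that W_zero W_zero, of 1] by simp
  \<comment> \<open>The pair \<open>(g, d)\<close> is chosen before \<open>k\<close>, so a single
    use of \<open>dual\<close> at this pair handles the whole weighted sum.\<close>
  have combination: "\<exists>g d. (g, d) \<in> W \<and> (\<forall>k\<in>C. (\<Sum>i\<in>I. t i * (k (fst i) - snd i)) = k g - d)"
    if "finite I" "I \<subseteq> W" for I and t :: "('b \<Rightarrow> real) \<times> real \<Rightarrow> real"
    using that
  proof (induction I rule: finite_induct)
    case empty
    then show ?case using W_zero k_zero by (intro exI[of _ "\<lambda>_. 0"] exI[of _ 0]) auto
  next
    case (insert i I)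
    then obtain g d where gd: "(g, d) \<in> W"
      "\<And>k. k \<in> C \<Longrightarrow> (\<Sum>i\<in>I. t i * (k (fst i) - snd i)) = k g - d" by auto
    obtain f c where i: "i = (f, c)" by (cases i)
    let ?g = "\<lambda>x. t i * f x + g x" and ?d = "t i * c + d"
    have fc: "(f, c) \<in> W" using insert.prems i by simp
    have "(?g, ?d) \<in> W" using W_lincomb[OF fc gd(1)] .
    moreover have "(\<Sum>i\<in>insert i I. t i * (k (fst i) - snd i)) = k ?g - ?d" if "k \<in> C" for k
    proof -
      have "(\<Sum>i\<in>insert i I. t i * (k (fst i) - snd i)) = t i * (k f - c) + (k g - d)"
        using insert.hyps gd(2)[OF that] i by simp
      then show ?thesis using linear[OF that fc gd(1), of "t i"] by (simp add: algebra_simps)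
    qed
    ultimately show ?case by blast
  qed
  \<comment> \<open>Evaluation at \<open>g\<close> is continuous, so each constraint cuts out a
    closed set, and the finite intersection property reduces the claim to finitely many
    constraints.\<close>
  have "C \<inter> \<Inter> ((\<lambda>(g, d). {k. k g = d}) ` W) \<noteq> {}"
  proof (rule compact_imp_fip_image[OF C(1)])
    show "closed (case i of (g, d) \<Rightarrow> {k. k g = d})" if "i \<in> W" for i :: "('b \<Rightarrow> real) \<times> real"
      by (cases i) (simp add: closed_Collect_eq)
  next
    fix I assume I: "finite I" "I \<subseteq> W"
    have "\<exists>k\<in>C. (\<Sum>i\<in>I. t i * (k (fst i) - snd i)) \<ge> 0" for t
      using combination[OF I, of t] dual by fastforce
    then obtain k where "k \<in> C" "\<forall>i\<in>I. k (fst i) = snd i"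
      using finite_constraints_solvable[OF C convex I(1)] by blast
    then have "k \<in> C \<inter> \<Inter> ((\<lambda>(g, d). {k. k g = d}) ` I)"
      by auto
    then show "C \<inter> \<Inter> ((\<lambda>(g, d). {k. k g = d}) ` I) \<noteq> {}" by blast
  qed
  then show ?thesis by fastforce
qed

section \<open>Integrals against ordered measures\<close>

lemma integrable_mono_measure:
  fixes f :: "'b \<Rightarrow> real"
  assumes "sets N = sets M" "N \<le> M" "integrable M f"
  shows "integrable N f"
proof -
  have "(\<integral>\<^sup>+x. norm (f x) \<partial>N) \<le> (\<integral>\<^sup>+x. norm (f x) \<partial>M)"
    using assms by (intro nn_integral_mono_measure)
  then show ?thesis
    using assms(3) measurable_cong_sets[OF assms(1) refl, of borel]
    unfolding integrable_iff_bounded by (auto simp: less_top[symmetric] top_unique)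
qed

lemma integral_mono_measure:
  fixes f :: "'b \<Rightarrow> real"
  assumes "sets N = sets M" "N \<le> M" "integrable M f" "\<And>x. x \<in> space M \<Longrightarrow> 0 \<le> f x"
  shows "integral\<^sup>L N f \<le> integral\<^sup>L M f"
proof -
  have sp: "space N = space M" using assms(1) by (rule sets_eq_imp_space_eq)
  have "ennreal (integral\<^sup>L N f) = (\<integral>\<^sup>+x. f x \<partial>N)"
    using integrable_mono_measure[OF assms(1-3)] assms(4) sp
    by (intro nn_integral_eq_integral[symmetric]) (auto intro!: AE_I2)
  also have "\<dots> \<le> (\<integral>\<^sup>+x. f x \<partial>M)"
    using assms by (intro nn_integral_mono_measure)
  also have "\<dots> = ennreal (integral\<^sup>L M f)"
    using assms by (intro nn_integral_eq_integral) (auto intro!: AE_I2)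
  finally show ?thesis
    using assms(4) by (subst (asm) ennreal_le_iff) (auto intro!: Bochner_Integration.integral_nonneg)
qed

section \<open>Functionals between two finite measures\<close>

locale measure_interval =
  lower: finite_measure \<phi> + upper: finite_measure \<psi> for \<phi> \<psi> :: "'b measure" +
  assumes sets_eq: "sets \<phi> = sets \<psi>" and le: "\<phi> \<le> \<psi>"
begin

lemma space_eq: "space \<phi> = space \<psi>"
  using sets_eq by (rule sets_eq_imp_space_eq)

lemmas integrable_lower = integrable_mono_measure[OF sets_eq le]
lemmas integral_lower_le = integral_mono_measure[OF sets_eq le]

text \<open>The absolute bound is imposed at every \<open>g\<close>, integrable or not, so that each
  coordinate of \<open>k\<close> ranges over a bounded interval and Tychonoff applies. At integrable
  functions it also gives continuity in the \<open>L1\<close> norm.\<close>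

definition functionals :: "(('b \<Rightarrow> real) \<Rightarrow> real) set" where
  "functionals = {k. (\<forall>g. \<bar>k g\<bar> \<le> (\<integral>x. \<bar>g x\<bar> \<partial>\<psi>)) \<and>
     (\<forall>f g t. integrable \<psi> f \<longrightarrow> integrable \<psi> g \<longrightarrow>
       k (\<lambda>x. t * f x + g x) = t * k f + k g) \<and>
     (\<forall>g. integrable \<psi> g \<longrightarrow> (\<forall>x\<in>space \<psi>. 0 \<le> g x) \<longrightarrow>
       integral\<^sup>L \<phi> g \<le> k g \<and> k g \<le> integral\<^sup>L \<psi> g)}"

lemma functionals_linear:
  assumes "k \<in> functionals" "integrable \<psi> f" "integrable \<psi> g"
  shows "k (\<lambda>x. t * f x + g x) = t * k f + k g"
  using assms by (simp add: functionals_def)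

lemma functionals_bounds:
  assumes "k \<in> functionals" "integrable \<psi> g" "\<And>x. x \<in> space \<psi> \<Longrightarrow> 0 \<le> g x"
  shows "integral\<^sup>L \<phi> g \<le> k g" "k g \<le> integral\<^sup>L \<psi> g"
  using assms by (auto simp: functionals_def)

lemma functionals_abs: "k \<in> functionals \<Longrightarrow> \<bar>k g\<bar> \<le> (\<integral>x. \<bar>g x\<bar> \<partial>\<psi>)"
  by (auto simp: functionals_def)

text \<open>Each instance of linearity or of the order bounds involves only finitely many values of
  \<open>k\<close>, so it is closed under pointwise convergence. The absolute bound supplies the
  compact product.\<close>

lemma compact_functionals: "compact functionals"
proof -
  let ?B = "{k. \<forall>g. \<bar>k g\<bar> \<le> (\<integral>x. \<bar>g x\<bar> \<partial>\<psi>)} :: (('b \<Rightarrow> real) \<Rightarrow> real) set"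
  let ?L = "{k. \<forall>f g t. integrable \<psi> f \<longrightarrow> integrable \<psi> g \<longrightarrow>
       k (\<lambda>x. t * f x + g x) = t * k f + k g} :: (('b \<Rightarrow> real) \<Rightarrow> real) set"
  let ?M = "{k. \<forall>g. integrable \<psi> g \<longrightarrow> (\<forall>x\<in>space \<psi>. 0 \<le> g x) \<longrightarrow>
       integral\<^sup>L \<phi> g \<le> k g \<and> k g \<le> integral\<^sup>L \<psi> g} :: (('b \<Rightarrow> real) \<Rightarrow> real) set"
  have "closed ?L"
    by (intro closed_Collect_all closed_Collect_imp closed_Collect_eq continuous_intros
        continuous_on_product_coordinates) auto
  moreover have "closed ?M"
    by (intro closed_Collect_all closed_Collect_imp closed_Collect_conj closed_Collect_le
        continuous_intros continuous_on_product_coordinates) auto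
  ultimately have "compact (?B \<inter> (?L \<inter> ?M))"
    by (intro compact_Int_closed compact_pointwise_bounded closed_Int)
  also have "?B \<inter> (?L \<inter> ?M) = functionals"
    by (auto simp: functionals_def)
  finally show ?thesis .
qed

lemma convex_functionals:
  assumes k: "k \<in> functionals" and l: "l \<in> functionals" and u: "0 \<le> u" "u \<le> 1"
  shows "(\<lambda>g. (1 - u) * k g + u * l g) \<in> functionals"
  unfolding functionals_def
proof (intro CollectI conjI allI impI)
  fix g :: "'b \<Rightarrow> real"
  have "\<bar>(1 - u) * k g + u * l g\<bar> \<le> (1 - u) * \<bar>k g\<bar> + u * \<bar>l g\<bar>"
    using u abs_triangle_ineq[of "(1 - u) * k g" "u * l g"] by (simp add: abs_mult)
  also have "\<dots> \<le> (\<integral>x. \<bar>g x\<bar> \<partial>\<psi>)"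
    using u functionals_abs[OF k, of g] functionals_abs[OF l, of g]
    by (intro convex_bound_le) auto
  finally show "\<bar>(1 - u) * k g + u * l g\<bar> \<le> (\<integral>x. \<bar>g x\<bar> \<partial>\<psi>)" .
next
  fix f g :: "'b \<Rightarrow> real" and t assume "integrable \<psi> f" "integrable \<psi> g"
  then show "(1 - u) * k (\<lambda>x. t * f x + g x) + u * l (\<lambda>x. t * f x + g x) =
      t * ((1 - u) * k f + u * l f) + ((1 - u) * k g + u * l g)"
    using functionals_linear[OF k, of f g t] functionals_linear[OF l, of f g t]
    by (simp add: algebra_simps)
next
  fix g :: "'b \<Rightarrow> real" assume g: "integrable \<psi> g" "\<forall>x\<in>space \<psi>. 0 \<le> g x"
  show "(1 - u) * k g + u * l g \<le> integral\<^sup>L \<psi> g"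
    using u functionals_bounds(2)[OF k g(1)] functionals_bounds(2)[OF l g(1)] g(2)
    by (intro convex_bound_le) auto
  \<comment> \<open>\<open>convex_bound_le\<close> gives upper bounds only, hence the negated form
    of the lower bound.\<close>
  have "(1 - u) * - k g + u * - l g \<le> - integral\<^sup>L \<phi> g"
    using u functionals_bounds(1)[OF k g(1)] functionals_bounds(1)[OF l g(1)] g(2)
    by (intro convex_bound_le) auto
  then show "integral\<^sup>L \<phi> g \<le> (1 - u) * k g + u * l g" by simp
qed

text \<open>The best choice takes the larger measure where \<open>G\<close> is nonnegative and the
  smaller one where \<open>G\<close> is negative.\<close>

lemma functional_attaining_sup:
  assumes G: "integrable \<psi> G"
  shows "\<exists>k\<in>functionals. k G = (\<integral>x. max (G x) 0 \<partial>\<psi>) - (\<integral>x. max (- G x) 0 \<partial>\<phi>)"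
proof
  define P where "P = {x \<in> space \<psi>. G x \<ge> 0}"
  have [measurable]: "G \<in> borel_measurable \<psi>" using G by auto
  have P[measurable]: "P \<in> sets \<psi>" by (simp add: P_def)
  have P': "P \<in> sets \<phi>" using P sets_eq by simp
  \<comment> \<open>The value \<open>0\<close> at non-integrable functions satisfies the absolute
    bound, whose right side is never negative.\<close>
  define k where "k g = (if integrable \<psi> g
      then (\<integral>x. indicator P x * g x \<partial>\<psi>) + (\<integral>x. indicator (- P) x * g x \<partial>\<phi>) else 0)" for g :: "'b \<Rightarrow> real"
  have i1: "integrable \<psi> (\<lambda>x. indicator P x * g x)" if "integrable \<psi> g" for g :: "'b \<Rightarrow> real"
    using integrable_mult_indicator[OF P that] by simp
  have i2: "integrable \<psi> (\<lambda>x. indicator (- P) x * g x)" if "integrable \<psi> g" for g :: "'b \<Rightarrow> real"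
  proof -
    have "integrable \<psi> (\<lambda>x. g x - indicator P x * g x)"
      using that i1[OF that] by simp
    also have "(\<lambda>x. g x - indicator P x * g x) = (\<lambda>x. indicator (- P) x * g x)"
      by (auto simp: indicator_def)
    finally show ?thesis .
  qed
  note i3 = integrable_lower[OF i2]
  have i4: "integrable \<phi> (\<lambda>x. indicator P x * g x)" if "integrable \<psi> g" for g :: "'b \<Rightarrow> real"
    using i1[OF that] by (rule integrable_lower)
  have split_upper: "integral\<^sup>L \<psi> g = (\<integral>x. indicator P x * g x \<partial>\<psi>) + (\<integral>x. indicator (- P) x * g x \<partial>\<psi>)"
    if "integrable \<psi> g" for g :: "'b \<Rightarrow> real"
    unfolding Bochner_Integration.integral_add[OF i1[OF that] i2[OF that], symmetric]
    by (rule Bochner_Integration.integral_cong) (auto simp: indicator_def)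
  have split_lower: "integral\<^sup>L \<phi> g = (\<integral>x. indicator P x * g x \<partial>\<phi>) + (\<integral>x. indicator (- P) x * g x \<partial>\<phi>)"
    if "integrable \<psi> g" for g :: "'b \<Rightarrow> real"
    unfolding Bochner_Integration.integral_add[OF i4[OF that] i3[OF that], symmetric]
    by (rule Bochner_Integration.integral_cong) (auto simp: indicator_def)
  \<comment> \<open>The pieces on \<open>P\<close> and off \<open>P\<close> are compared separately:
    \<open>k\<close> agrees with \<psi> on the first and with \<phi> on the second, and \<phi> \<le>
    \<psi> settles the other piece in each case.\<close>
  have k_le: "k g \<le> integral\<^sup>L \<psi> g" and k_ge: "integral\<^sup>L \<phi> g \<le> k g"
    if "integrable \<psi> g" "\<forall>x\<in>space \<psi>. 0 \<le> g x" for g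
    using that integral_lower_le[OF i1[of g]] integral_lower_le[OF i2[of g]]
      split_upper[of g] split_lower[of g] by (auto simp: k_def)
  have k_lin: "k (\<lambda>x. t * f x + g x) = t * k f + k g" if "integrable \<psi> f" "integrable \<psi> g" for f g t
    using that i1[of f] i1[of g] i3[of f] i3[of g]
    by (simp add: k_def distrib_left mult.left_commute[of _ t])
  have k_mono: "k f \<le> k g" if "integrable \<psi> f" "integrable \<psi> g" "\<forall>x\<in>space \<psi>. f x \<le> g x" for f g
  proof -
    have "0 \<le> integral\<^sup>L \<phi> (\<lambda>x. -1 * f x + g x)"
      using that space_eq by (intro Bochner_Integration.integral_nonneg) auto
    also have "\<dots> \<le> k (\<lambda>x. -1 * f x + g x)" using that by (intro k_ge) auto
    also have "\<dots> = - k f + k g" using k_lin[OF that(1,2), of "-1"] by simp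
    finally show ?thesis by simp
  qed
  show "k \<in> functionals"
    unfolding functionals_def
  proof (intro CollectI conjI allI impI)
    fix g :: "'b \<Rightarrow> real"
    show "\<bar>k g\<bar> \<le> (\<integral>x. \<bar>g x\<bar> \<partial>\<psi>)"
    proof (cases "integrable \<psi> g")
      case True
      then have a: "integrable \<psi> (\<lambda>x. \<bar>g x\<bar>)" by simp
      \<comment> \<open>Monotonicity puts \<open>k g\<close> between the values of \<open>k\<close>
        at the negated and the plain absolute value of \<open>g\<close>. The added \<open>0\<close>
        gives the shape that \<open>k_lin\<close> expects.\<close>
      have "k (\<lambda>x. -1 * \<bar>g x\<bar> + 0) = -1 * k (\<lambda>x. \<bar>g x\<bar>) + k (\<lambda>_. 0)" by (rule k_lin[OF a]) simp
      moreover have "k (\<lambda>_. 0) = 0" by (simp add: k_def)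
      moreover have "k (\<lambda>x. -1 * \<bar>g x\<bar> + 0) \<le> k g" "k g \<le> k (\<lambda>x. \<bar>g x\<bar>)"
        using True by (auto intro!: k_mono)
      ultimately show ?thesis using k_le[OF a] by simp
    qed (simp add: k_def)
  qed (use k_lin k_le k_ge in auto)
  have "(\<integral>x. indicator P x * G x \<partial>\<psi>) = (\<integral>x. max (G x) 0 \<partial>\<psi>)"
    by (rule Bochner_Integration.integral_cong) (auto simp: P_def indicator_def)
  moreover have "(\<integral>x. indicator (- P) x * G x \<partial>\<phi>) = (\<integral>x. - max (- G x) 0 \<partial>\<phi>)"
    by (rule Bochner_Integration.integral_cong) (auto simp: P_def indicator_def space_eq)
  ultimately show "k G = (\<integral>x. max (G x) 0 \<partial>\<psi>) - (\<integral>x. max (- G x) 0 \<partial>\<phi>)"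
    using G by (simp add: k_def)
qed

end

section \<open>Passing between set functions and measures\<close>

lemma le_measure_iff_measure_le:
  assumes "finite_measure M" "finite_measure N" "sets M = sets N"
  shows "M \<le> N \<longleftrightarrow> (\<forall>A\<in>sets M. measure M A \<le> measure N A)"
proof -
  interpret M: finite_measure M by fact
  interpret N: finite_measure N by fact
  show ?thesis
    by (simp add: le_measure[OF assms(3)] M.emeasure_eq_measure N.emeasure_eq_measure)
qed

text \<open>Nonnegativity makes the conversion to \<open>ennreal\<close> lossless, so countable
  additivity carries over; finiteness holds because the values are real.\<close>

lemma nonneg_signed_measure_obtains_measure:
  assumes \<alpha>: "finite_signed_measure N \<alpha>" and nonneg: "\<And>A. A \<in> sets N \<Longrightarrow> 0 \<le> \<alpha> A"
  obtains M where "sets M = sets N" "finite_measure M" "\<And>A. A \<in> sets N \<Longrightarrow> measure M A = \<alpha> A"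
proof -
  define M where "M = measure_of (space N) (sets N) (\<lambda>A. ennreal (\<alpha> A))"
  have sets_M: "sets M = sets N" by (simp add: M_def)
  have space_M: "space M = space N" using sets_M by (rule sets_eq_imp_space_eq)
  have "countably_additive (sets M) (\<lambda>A. ennreal (\<alpha> A))"
    unfolding countably_additive_def sets_M
  proof (intro allI impI)
    fix A :: "nat \<Rightarrow> _" assume A: "range A \<subseteq> sets N" "disjoint_family A"
    then have "(\<lambda>i. \<alpha> (A i)) sums \<alpha> (\<Union>i. A i)"
      using \<alpha> by (simp add: finite_signed_measure_def)
    moreover have "0 \<le> \<alpha> (A i)" for i using A(1) by (intro nonneg) auto
    ultimately show "(\<Sum>i. ennreal (\<alpha> (A i))) = ennreal (\<alpha> (\<Union>i. A i))"
      by (simp add: suminf_ennreal2 sums_iff)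
  qed
  moreover have "positive (sets M) (\<lambda>A. ennreal (\<alpha> A))"
    using \<alpha> by (simp add: positive_def finite_signed_measure_def)
  ultimately have emeasure_M: "emeasure M A = ennreal (\<alpha> A)" if "A \<in> sets N" for A
    using that sets_M sets.space_closed[of N] by (intro emeasure_measure_of[OF M_def]) auto
  show thesis
  proof (rule that)
    show "sets M = sets N" by fact
    show "measure M A = \<alpha> A" if "A \<in> sets N" for A
      using emeasure_M[OF that] nonneg[OF that] by (simp add: measure_def)
    show "finite_measure M"
      by (rule finite_measureI) (simp add: space_M emeasure_M)
  qed
qed

lemma finite_signed_measure_measure:
  assumes "finite_measure M" "sets M = sets N"
  shows "finite_signed_measure N (measure M)"
proof -
  interpret finite_measure M by fact
  show ?thesis
    unfolding finite_signed_measure_def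
    using finite_measure_UNION assms(2) by simp
qed

text \<open>By monotonicity of \<open>M\<close> the supremum defining the positive variation is
  attained at \<open>B = A\<close>, so the positive variation is \<open>M\<close> itself and the
  negative one vanishes.\<close>

lemma signed_integral_eq_integral:
  assumes "finite_measure M" and sets_M: "sets M = sets N"
    and eq: "\<And>A. A \<in> sets N \<Longrightarrow> \<alpha> A = measure M A"
  shows "signed_integral N \<alpha> g = integral\<^sup>L M g"
proof -
  interpret finite_measure M by fact
  have space_M: "space M = space N" using sets_M by (rule sets_eq_imp_space_eq)
  have "positive_variation N \<alpha> = measure_of (space N) (sets N) (emeasure M)"
    unfolding positive_variation_def
  proof (rule measure_of_eq[OF sets.space_closed])
    fix A assume "A \<in> sigma_sets (space N) (sets N)"
    then have A: "A \<in> sets N" by (simp add: sets.sigma_sets_eq)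
    show "(SUP B\<in>{B \<in> sets N. B \<subseteq> A}. ennreal (\<alpha> B)) = emeasure M A"
      using A by (intro antisym SUP_least SUP_upper2[of A])
        (auto simp: eq emeasure_eq_measure sets_M intro!: ennreal_leI finite_measure_mono)
  qed
  also have "\<dots> = M" using measure_of_of_measure[of M] by (simp add: sets_M space_M)
  finally have pos: "positive_variation N \<alpha> = M" .
  \<comment> \<open>All values under the supremum are nonpositive reals, which
    \<open>ennreal\<close> sends to \<open>0\<close>.\<close>
  have "positive_variation N (\<lambda>A. - \<alpha> A) = null_measure N"
    unfolding positive_variation_def null_measure_def
    by (rule measure_of_eq[OF sets.space_closed])
      (auto simp: eq sets.sigma_sets_eq ennreal_neg intro!: antisym SUP_least)
  then show ?thesis by (simp add: signed_integral_def pos)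
qed

section \<open>Representation of functionals by measures\<close>

context measure_interval
begin

text \<open>Dominated convergence for \<open>k\<close>: the absolute bound controls
  \<open>k (s i) - k f\<close> by the \<open>L1\<close> distance under \<psi>, which tends to
  \<open>0\<close> by the classical theorem.\<close>

lemma functionals_convergence:
  assumes k: "k \<in> functionals" and f: "integrable \<psi> f" and s: "\<And>i. integrable \<psi> (s i)"
    and w: "integrable \<psi> w"
    and lim: "\<And>x. x \<in> space \<psi> \<Longrightarrow> (\<lambda>i. s i x) \<longlonglongrightarrow> f x"
    and bound: "\<And>i x. x \<in> space \<psi> \<Longrightarrow> \<bar>s i x\<bar> \<le> w x"
  shows "(\<lambda>i::nat. k (s i)) \<longlonglongrightarrow> k f"
proof -
  have "(\<lambda>i. \<integral>x. \<bar>- 1 * f x + s i x\<bar> \<partial>\<psi>) \<longlonglongrightarrow> (\<integral>x. 0 \<partial>\<psi>)"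
  proof (rule integral_dominated_convergence[where w = "\<lambda>x. \<bar>f x\<bar> + w x"])
    show "AE x in \<psi>. (\<lambda>i. \<bar>- 1 * f x + s i x\<bar>) \<longlonglongrightarrow> 0"
      by (rule AE_I2) (auto intro!: tendsto_eq_intros lim)
    show "AE x in \<psi>. norm \<bar>- 1 * f x + s i x\<bar> \<le> \<bar>f x\<bar> + w x" for i
    proof (rule AE_I2)
      fix x assume "x \<in> space \<psi>"
      then have "\<bar>s i x\<bar> \<le> w x" by (rule bound)
      then show "norm \<bar>- 1 * f x + s i x\<bar> \<le> \<bar>f x\<bar> + w x"
        using abs_triangle_ineq[of "- f x" "s i x"] by simp
    qed
  qed (use f s w in auto)
  then have null: "(\<lambda>i. \<integral>x. \<bar>- 1 * f x + s i x\<bar> \<partial>\<psi>) \<longlonglongrightarrow> 0" by simp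
  have "\<bar>k (s i) - k f\<bar> \<le> (\<integral>x. \<bar>- 1 * f x + s i x\<bar> \<partial>\<psi>)" for i
    using functionals_abs[OF k, of "\<lambda>x. - 1 * f x + s i x"] functionals_linear[OF k f s, of "-1" i]
    by simp
  then have "(\<lambda>i. k (s i) - k f) \<longlonglongrightarrow> 0"
    by (intro Lim_null_comparison[OF _ null] always_eventually) simp
  then show ?thesis by (simp add: LIM_zero_iff)
qed

lemma functionals_zero: "k \<in> functionals \<Longrightarrow> k (\<lambda>_. 0) = 0"
  using functionals_abs[of k "\<lambda>_. 0"] by simp

lemma indicator_empty: "indicator {} = (\<lambda>_. 0 :: real)"
  by (simp add: fun_eq_iff)

lemma functionals_add:
  "k \<in> functionals \<Longrightarrow> integrable \<psi> f \<Longrightarrow> integrable \<psi> g \<Longrightarrow> k (\<lambda>x. f x + g x) = k f + k g"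
  using functionals_linear[of k f g 1] by simp

lemma integrable_indicator_upper: "A \<in> sets \<psi> \<Longrightarrow> integrable \<psi> (indicator A :: 'b \<Rightarrow> real)"
  by (simp add: upper.emeasure_finite less_top[symmetric])

text \<open>Linearity gives finite additivity. Countable additivity follows by dominated convergence
  of the indicators of the partial unions, with the constant \<open>1\<close> as dominating
  function.\<close>

lemma functionals_signed_measure:
  assumes k: "k \<in> functionals"
  shows "finite_signed_measure \<psi> (\<lambda>A. k (indicator A))"
  unfolding finite_signed_measure_def
proof (intro conjI allI impI)
  show "k (indicator {}) = 0" unfolding indicator_empty using functionals_zero[OF k] by simp
  fix A :: "nat \<Rightarrow> 'b set" assume A: "range A \<subseteq> sets \<psi>" "disjoint_family A"
  have part: "(\<Sum>i<n. k (indicator (A i))) = k (indicator (\<Union>i<n. A i))" for n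
  proof (induction n)
    case 0
    show ?case unfolding indicator_empty using functionals_zero[OF k] by simp
  next
    case (Suc n)
    have "A i \<inter> A n = {}" if "i < n" for i
      using A(2) that by (simp add: disjoint_family_on_def)
    then have disj: "(\<Union>i<n. A i) \<inter> A n = {}" by blast
    have "indicator (\<Union>i<Suc n. A i) = (indicator ((\<Union>i<n. A i) \<union> A n) :: 'b \<Rightarrow> real)"
      by (simp add: lessThan_Suc Un_commute)
    also have "\<dots> = (\<lambda>x. indicator (\<Union>i<n. A i) x + indicator (A n) x)"
      by (rule ext) (rule indicator_add[OF disj, symmetric])
    finally have eq: "indicator (\<Union>i<Suc n. A i) =
      (\<lambda>x. indicator (\<Union>i<n. A i) x + indicator (A n) x :: real)" .
    have "A n \<in> sets \<psi>" "(\<Union>i<n. A i) \<in> sets \<psi>" using A(1) by auto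
    then have "k (indicator (\<Union>i<Suc n. A i)) = k (indicator (\<Union>i<n. A i)) + k (indicator (A n))"
      unfolding eq by (intro functionals_add[OF k] integrable_indicator_upper)
    then show ?case using Suc by simp
  qed
  have "(\<lambda>n. k (indicator (\<Union>i<n. A i))) \<longlonglongrightarrow> k (indicator (\<Union>i. A i))"
    by (rule functionals_convergence[OF k, where w = "\<lambda>_. 1"])
      (use A(1) in \<open>auto intro!: integrable_indicator_upper LIMSEQ_indicator_UN simp: indicator_le_1\<close>)
  then show "(\<lambda>i. k (indicator (A i))) sums k (indicator (\<Union>i. A i))"
    by (simp add: sums_def part)
qed

text \<open>A Riesz representation: the values at indicators define \<open>M\<close>, and agreement
  spreads from indicators to sums and then to dominated limits.\<close>

lemma functionals_representation:
  assumes k: "k \<in> functionals"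
  obtains M where "sets M = sets \<psi>" "\<phi> \<le> M" "M \<le> \<psi>"
    "\<And>g. integrable \<psi> g \<Longrightarrow> integral\<^sup>L M g = k g"
proof -
  have bounds: "measure \<phi> A \<le> k (indicator A)" "k (indicator A) \<le> measure \<psi> A" if "A \<in> sets \<psi>" for A
    using functionals_bounds[OF k integrable_indicator_upper[OF that]] that sets_eq by auto
  have nonneg: "0 \<le> k (indicator A)" if "A \<in> sets \<psi>" for A
    using bounds(1)[OF that] by (rule order_trans[OF measure_nonneg])
  obtain M where M: "sets M = sets \<psi>" "finite_measure M"
      "\<And>A. A \<in> sets \<psi> \<Longrightarrow> measure M A = k (indicator A)"
    using nonneg_signed_measure_obtains_measure[OF functionals_signed_measure[OF k] nonneg] by metis
  interpret M: finite_measure M by fact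
  have le_M: "\<phi> \<le> M" "M \<le> \<psi>"
    using bounds M sets_eq
    by (simp_all add: le_measure_iff_measure_le lower.finite_measure_axioms upper.finite_measure_axioms)
  have "integral\<^sup>L M g = k g" if "integrable \<psi> g" for g
    using that
  proof (induction g rule: integrable_induct)
    case (base A c)
    have "k (\<lambda>x. c * indicator A x + 0) = c * k (indicator A) + k (\<lambda>_. 0)"
      using base by (intro functionals_linear[OF k]) (auto intro: integrable_indicator_upper)
    then show ?case using base M by (simp add: functionals_zero[OF k] mult.commute)
  next
    case (add f g)
    then show ?case
      using integrable_mono_measure[OF M(1) le_M(2)] by (simp add: functionals_add[OF k])
  next
    \<comment> \<open>The same dominating function \<open>2 * norm (f x)\<close> serves for
      \<open>k\<close> and for \<open>M\<close>, since \<open>M\<close> \<le> \<psi> preserves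
      integrability; uniqueness of limits finishes.\<close>
    case (lim f s)
    note int = integrable_mono_measure[OF M(1) le_M(2)]
    have sp: "space M = space \<psi>" using M(1) by (rule sets_eq_imp_space_eq)
    have "(\<lambda>i. k (s i)) \<longlonglongrightarrow> k f"
      using lim by (intro functionals_convergence[OF k, where w = "\<lambda>x. 2 * norm (f x)"]) auto
    moreover have "(\<lambda>i. integral\<^sup>L M (s i)) \<longlonglongrightarrow> integral\<^sup>L M f"
      using lim int sp
      by (intro integral_dominated_convergence[where w = "\<lambda>x. 2 * norm (f x)"]) auto
    ultimately show ?case using lim by (simp add: LIMSEQ_unique)
  qed
  with M(1) le_M show thesis by (rule that)
qed

text \<open>The right side of \<open>W_dual\<close> is the value reached by
  \<open>functional_attaining_sup\<close>, so \<open>W_dual\<close> is the hypothesis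
  \<open>dual\<close> of \<open>constraints_solvable\<close> for the functionals; the solution is
  then represented by a measure.\<close>

theorem interpolating_measure:
  fixes W :: "(('b \<Rightarrow> real) \<times> real) set"
  assumes W_zero: "(\<lambda>_. 0, 0) \<in> W"
    and W_lincomb: "\<And>f c g d t. (f, c) \<in> W \<Longrightarrow> (g, d) \<in> W \<Longrightarrow> (\<lambda>x. t * f x + g x, t * c + d) \<in> W"
    and W_integrable: "\<And>g d. (g, d) \<in> W \<Longrightarrow> integrable \<psi> g"
    and W_dual: "\<And>g d. (g, d) \<in> W \<Longrightarrow>
      d \<le> (\<integral>x. max (g x) 0 \<partial>\<psi>) - (\<integral>x. max (- g x) 0 \<partial>\<phi>)"
  obtains M where "sets M = sets \<psi>" "\<phi> \<le> M" "M \<le> \<psi>" "\<And>g d. (g, d) \<in> W \<Longrightarrow> integral\<^sup>L M g = d"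
proof -
  have "\<exists>k\<in>functionals. \<forall>(g, d)\<in>W. k g = d"
  proof (rule constraints_solvable[OF compact_functionals])
    show "functionals \<noteq> {}" using functional_attaining_sup[of "\<lambda>_. 0"] by auto
    fix g d assume gd: "(g, d) \<in> W"
    obtain k where "k \<in> functionals" "k g = (\<integral>x. max (g x) 0 \<partial>\<psi>) - (\<integral>x. max (- g x) 0 \<partial>\<phi>)"
      using functional_attaining_sup[OF W_integrable[OF gd]] by blast
    then show "\<exists>k\<in>functionals. d \<le> k g"
      using W_dual[OF gd] by (intro bexI[of _ k]) simp
  next
    show "k (\<lambda>x. t * f x + g x) = t * k f + k g"
      if "k \<in> functionals" "(f, c) \<in> W" "(g, d) \<in> W" for k f c g d t
      using functionals_linear[OF that(1) W_integrable[OF that(2)] W_integrable[OF that(3)]] .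
  qed (fact convex_functionals W_zero W_lincomb)+
  then obtain k where k: "k \<in> functionals" "\<forall>(g, d)\<in>W. k g = d" by blast
  obtain M where M: "sets M = sets \<psi>" "\<phi> \<le> M" "M \<le> \<psi>"
    "\<And>g. integrable \<psi> g \<Longrightarrow> integral\<^sup>L M g = k g"
    by (rule functionals_representation[OF k(1)]) (rule that)
  show thesis
  proof (rule that)
    show "integral\<^sup>L M g = d" if "(g, d) \<in> W" for g d
      using M(4)[OF W_integrable[OF that]] k(2) that by auto
  qed (fact M)+
qed

end

section \<open>Extended integrals, measures with equal marginals, and potentials\<close>

lemma ext_integral_eq_integral:
  assumes "integrable M g" "\<And>x. x \<in> space M \<Longrightarrow> 0 \<le> g x"
  shows "ext_integral M g = ereal (integral\<^sup>L M g)"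
proof -
  have "(\<integral>\<^sup>+x. ennreal (g x) \<partial>M) = ennreal (integral\<^sup>L M g)"
    using assms by (intro nn_integral_eq_integral) (auto intro: AE_I2)
  moreover have "0 \<le> integral\<^sup>L M g"
    using assms by (intro Bochner_Integration.integral_nonneg) auto
  ultimately show ?thesis by (simp add: ext_integral_def enn2ereal_ennreal)
qed

lemma ext_integral_mono_measure:
  "sets M = sets N \<Longrightarrow> M \<le> N \<Longrightarrow> ext_integral M g \<le> ext_integral N g"
  by (simp add: ext_integral_def less_eq_ennreal.rep_eq[symmetric] nn_integral_mono_measure)

text \<open>The form that a nonnegative circulation takes as a genuine measure.\<close>

locale balanced_measure = finite_measure M for M :: "('a \<times> 'a) measure" +
  fixes J :: "'a measure"
  assumes sets_M: "sets M = sets (J \<Otimes>\<^sub>M J)"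
    and balanced: "\<And>A. A \<in> sets J \<Longrightarrow> measure M (A \<times> space J) = measure M (space J \<times> A)"
begin

lemma measurable_M: "measurable M N = measurable (J \<Otimes>\<^sub>M J) N"
  by (rule measurable_cong_sets[OF sets_M refl])

lemma space_M: "space M = space J \<times> space J"
  using sets_eq_imp_space_eq[OF sets_M] by (simp add: space_pair_measure)

text \<open>The two rectangles in \<open>balanced\<close> are the preimages of \<open>A\<close>
  under the projections, so the condition says that the marginals agree.\<close>

lemma distr_fst_eq_distr_snd: "distr M J fst = distr M J snd"
proof (rule measure_eqI)
  fix A assume "A \<in> sets (distr M J fst)"
  then have A: "A \<in> sets J" by simp
  then have "fst -` A \<inter> space M = A \<times> space J" "snd -` A \<inter> space M = space J \<times> A"
    using sets.sets_into_space by (auto simp: space_M)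
  then show "emeasure (distr M J fst) A = emeasure (distr M J snd) A"
    using A balanced[OF A] by (simp add: emeasure_distr measurable_M emeasure_eq_measure)
qed simp

lemma integral_fst_eq_integral_snd:
  fixes f :: "'a \<Rightarrow> real"
  assumes "f \<in> borel_measurable J"
  shows "(\<integral>p. f (fst p) \<partial>M) = (\<integral>p. f (snd p) \<partial>M)"
proof -
  have "fst \<in> measurable M J" "snd \<in> measurable M J" by (simp_all add: measurable_M)
  then show ?thesis
    using integral_distr[of fst M J f] integral_distr[of snd M J f] assms
    by (simp add: distr_fst_eq_distr_snd)
qed

text \<open>Clamping \<open>f\<close> to \<open>[-n, n]\<close> shrinks both parts of the difference, so the integral of the
  negative part of the clamped difference stays below that of the full positive part.\<close>

lemma potential_integral_zero:
  fixes f :: "'a \<Rightarrow> real"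
  defines "d \<equiv> \<lambda>p. f (fst p) - f (snd p)"
  assumes f[measurable]: "f \<in> borel_measurable J"
    and fin: "(\<integral>\<^sup>+p. ennreal (max (d p) 0) \<partial>M) < \<infinity>"
  shows "integrable M d" "integral\<^sup>L M d = 0"
proof -
  define h where "h n x = max (- real n) (min (real n) (f x))" for n x
  define e where "e n p = h n (fst p) - h n (snd p)" for n p
  have h[measurable]: "h n \<in> borel_measurable J" for n unfolding h_def[abs_def] by simp
  have [measurable]: "fst \<in> measurable M J" "snd \<in> measurable M J" by (simp_all add: measurable_M)
  have d[measurable]: "d \<in> borel_measurable M" by (simp add: d_def)
  have e[measurable]: "e n \<in> borel_measurable M" for n unfolding e_def[abs_def] by simp
  have h_bound: "\<bar>h n x\<bar> \<le> real n" for n x by (auto simp: h_def)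
  have int_h: "integrable M (\<lambda>p. h n (fst p))" "integrable M (\<lambda>p. h n (snd p))" for n
    using h_bound by (auto intro!: integrable_const_bound[where B = "real n"])
  have int_e: "integrable M (e n)" for n unfolding e_def[abs_def] using int_h by simp
  \<comment> \<open>Clamping makes both terms integrable separately, so equality of marginals
    cancels them. The two terms of \<open>d\<close> itself may fail to be integrable.\<close>
  have e_zero: "integral\<^sup>L M (e n) = 0" for n
    unfolding e_def[abs_def] using int_h integral_fst_eq_integral_snd[OF h] by simp
  have e_pos: "max (e n p) 0 \<le> max (d p) 0" for n p by (auto simp: e_def h_def d_def)
  have e_abs: "\<bar>e n p\<bar> \<le> \<bar>d p\<bar>" for n p by (auto simp: e_def h_def d_def)
  have e_lim: "(\<lambda>n. e n p) \<longlonglongrightarrow> d p" for p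
  proof -
    obtain N where N: "max \<bar>f (fst p)\<bar> \<bar>f (snd p)\<bar> \<le> real N" using real_arch_simple by blast
    have "e n p = d p" if "n \<ge> N" for n
    proof -
      have "real N \<le> real n" using that by simp
      with N show ?thesis by (auto simp: e_def h_def d_def)
    qed
    then show ?thesis by (intro tendsto_eventually) (auto simp: eventually_sequentially)
  qed
  have neg_le: "(\<integral>\<^sup>+p. ennreal (max (- e n p) 0) \<partial>M) \<le> (\<integral>\<^sup>+p. ennreal (max (d p) 0) \<partial>M)" for n
  proof -
    have "integral\<^sup>L M (e n) = (\<integral>p. max (e n p) 0 - max (- e n p) 0 \<partial>M)"
      by (rule Bochner_Integration.integral_cong) auto
    also have "\<dots> = (\<integral>p. max (e n p) 0 \<partial>M) - (\<integral>p. max (- e n p) 0 \<partial>M)"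
      using int_e by simp
    finally have "(\<integral>p. max (- e n p) 0 \<partial>M) = (\<integral>p. max (e n p) 0 \<partial>M)"
      using e_zero by simp
    then have "(\<integral>\<^sup>+p. ennreal (max (- e n p) 0) \<partial>M) = (\<integral>\<^sup>+p. ennreal (max (e n p) 0) \<partial>M)"
      using int_e by (simp add: nn_integral_eq_integral)
    also have "\<dots> \<le> (\<integral>\<^sup>+p. ennreal (max (d p) 0) \<partial>M)"
      using e_pos by (intro nn_integral_mono ennreal_leI)
    finally show ?thesis .
  qed
  \<comment> \<open>Fatou's lemma transfers the uniform bound on the negative parts of
    \<open>e n\<close> to the negative part of \<open>d\<close>.\<close>
  have "(\<integral>\<^sup>+p. ennreal (max (- d p) 0) \<partial>M) =
      (\<integral>\<^sup>+p. liminf (\<lambda>n. ennreal (max (- e n p) 0)) \<partial>M)"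
    by (intro nn_integral_cong lim_imp_Liminf[symmetric] tendsto_ennrealI tendsto_intros e_lim) simp
  also have "\<dots> \<le> liminf (\<lambda>n. \<integral>\<^sup>+p. ennreal (max (- e n p) 0) \<partial>M)"
    by (rule nn_integral_liminf) simp
  also have "\<dots> \<le> (\<integral>\<^sup>+p. ennreal (max (d p) 0) \<partial>M)"
    using neg_le by (intro Liminf_le) auto
  finally have "(\<integral>\<^sup>+p. ennreal (max (- d p) 0) \<partial>M) < \<infinity>" using fin by (rule le_less_trans)
  moreover have "(\<integral>\<^sup>+p. ennreal (norm (d p)) \<partial>M) =
      (\<integral>\<^sup>+p. ennreal (max (d p) 0) + ennreal (max (- d p) 0) \<partial>M)"
    by (intro nn_integral_cong) (auto simp: ennreal_plus[symmetric] simp del: ennreal_plus)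
  moreover have "\<dots> = (\<integral>\<^sup>+p. ennreal (max (d p) 0) \<partial>M) + (\<integral>\<^sup>+p. ennreal (max (- d p) 0) \<partial>M)"
    by (rule nn_integral_add) auto
  ultimately show int_d: "integrable M d"
    using fin d by (simp add: integrable_iff_bounded)
  have "(\<lambda>n. integral\<^sup>L M (e n)) \<longlonglongrightarrow> integral\<^sup>L M d"
    using int_d e_lim e_abs
    by (intro integral_dominated_convergence[where w = "\<lambda>p. \<bar>d p\<bar>"]) auto
  then show "integral\<^sup>L M d = 0" using e_zero by (simp add: LIMSEQ_const_iff)
qed

text \<open>Under \<open>M\<close> the potential integrates to \<open>0\<close>, so the positive and
  negative parts of \<open>F + w\<close> differ by the integral of \<open>w\<close>. Replacing
  \<open>M\<close> by \<phi> in the negative part and by \<psi> in the positive part gives the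
  inequality. If the left side is infinite there is nothing to prove.\<close>

lemma potential_condition:
  assumes le: "\<phi> \<le> M" "M \<le> \<psi>" and sets: "sets \<phi> = sets M" "sets M = sets \<psi>"
    and w: "integrable M w" and F: "potential J F"
  shows "ext_integral \<psi> (\<lambda>p. pos_part (F p + w p))
    \<ge> ext_integral \<phi> (\<lambda>p. neg_part (F p + w p)) + ereal (integral\<^sup>L M w)"
proof (cases "ext_integral \<psi> (\<lambda>p. pos_part (F p + w p)) = \<infinity>")
  case False
  from F obtain f where f: "f \<in> borel_measurable J"
    and Ff: "\<And>x y. x \<in> space J \<Longrightarrow> y \<in> space J \<Longrightarrow> F (x, y) = f x - f y"
    by (auto simp: potential_def)
  have [measurable]: "F \<in> borel_measurable M" "w \<in> borel_measurable M"
    using F w by (auto simp: potential_def measurable_M)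
  have F_eq: "F p = f (fst p) - f (snd p)" if "p \<in> space M" for p
    using that Ff by (cases p) (auto simp: space_M)
  have "(\<integral>\<^sup>+p. ennreal (pos_part (F p + w p)) \<partial>\<psi>) < \<infinity>"
    using False by (auto simp: ext_integral_def less_top[symmetric])
  then have pos: "(\<integral>\<^sup>+p. ennreal (pos_part (F p + w p)) \<partial>M) < \<infinity>"
    using nn_integral_mono_measure[OF sets(2) le(2)] by (rule le_less_trans[rotated])
  \<comment> \<open>The positive part of \<open>F\<close> is at most that of \<open>F + w\<close>
    plus the absolute value of \<open>w\<close>; this provides the finiteness that
    \<open>potential_integral_zero\<close> requires.\<close>
  have "(\<integral>\<^sup>+p. ennreal (max (f (fst p) - f (snd p)) 0) \<partial>M) \<le>
      (\<integral>\<^sup>+p. ennreal (pos_part (F p + w p)) + ennreal (norm (w p)) \<partial>M)"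
    by (intro nn_integral_mono)
      (auto simp: F_eq pos_part_def ennreal_plus[symmetric] simp del: ennreal_plus intro!: ennreal_leI)
  also have "\<dots> = (\<integral>\<^sup>+p. ennreal (pos_part (F p + w p)) \<partial>M) + (\<integral>\<^sup>+p. ennreal (norm (w p)) \<partial>M)"
    by (rule nn_integral_add) (auto simp: pos_part_def)
  also have "\<dots> < \<infinity>"
    using pos w by (simp add: integrable_iff_bounded)
  finally have fin: "(\<integral>\<^sup>+p. ennreal (max (f (fst p) - f (snd p)) 0) \<partial>M) < \<infinity>" .
  have F_int: "integrable M F"
    using potential_integral_zero(1)[OF f fin] F_eq by (simp cong: Bochner_Integration.integrable_cong)
  have F_zero: "integral\<^sup>L M F = 0"
    using potential_integral_zero(2)[OF f fin] F_eq by (simp cong: Bochner_Integration.integral_cong)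
  have int: "integrable M (\<lambda>p. pos_part (F p + w p))" "integrable M (\<lambda>p. neg_part (F p + w p))"
    using F_int w by (auto simp: pos_part_def neg_part_def)
  have "integral\<^sup>L M (\<lambda>p. pos_part (F p + w p)) - integral\<^sup>L M (\<lambda>p. neg_part (F p + w p)) =
      (\<integral>p. pos_part (F p + w p) - neg_part (F p + w p) \<partial>M)"
    using int by simp
  also have "\<dots> = (\<integral>p. F p + w p \<partial>M)"
    by (rule Bochner_Integration.integral_cong) (auto simp: pos_part_def neg_part_def)
  also have "\<dots> = integral\<^sup>L M w" using F_int w F_zero by simp
  finally have "ext_integral M (\<lambda>p. pos_part (F p + w p)) =
      ext_integral M (\<lambda>p. neg_part (F p + w p)) + ereal (integral\<^sup>L M w)"
    using int by (simp add: ext_integral_eq_integral pos_part_def neg_part_def)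
  then have "ext_integral \<phi> (\<lambda>p. neg_part (F p + w p)) + ereal (integral\<^sup>L M w)
      \<le> ext_integral M (\<lambda>p. pos_part (F p + w p))"
    using add_right_mono[OF ext_integral_mono_measure[OF sets(1) le(1)]] by simp
  also have "\<dots> \<le> ext_integral \<psi> (\<lambda>p. pos_part (F p + w p))"
    by (rule ext_integral_mono_measure[OF sets(2) le(2)])
  finally show ?thesis .
qed simp

end

section \<open>The two directions of the equivalence\<close>

text \<open>Being at least \<phi>, the circulation is nonnegative and hence given by a measure, to
  which \<open>potential_condition\<close> applies with \<open>w\<close> equal to
  \<open>s * v\<close>.\<close>

lemma circulation_imp_potential_conditions:
  fixes J :: "'a measure" and v :: "'a \<times> 'a \<Rightarrow> real" and \<phi> \<psi> :: "('a \<times> 'a) measure"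
  assumes v: "v \<in> borel_measurable (J \<Otimes>\<^sub>M J)" "bounded (v ` space (J \<Otimes>\<^sub>M J))"
    and sets: "sets \<phi> = sets (J \<Otimes>\<^sub>M J)" "sets \<psi> = sets (J \<Otimes>\<^sub>M J)"
    and finite: "finite_measure \<phi>" "finite_measure \<psi>"
    and \<alpha>: "circulation J \<alpha>"
    and between: "\<forall>A\<in>sets (J \<Otimes>\<^sub>M J). measure \<phi> A \<le> \<alpha> A \<and> \<alpha> A \<le> measure \<psi> A"
    and F: "potential J F"
  shows "ext_integral \<psi> (\<lambda>p. pos_part (F p + s * v p))
    \<ge> ext_integral \<phi> (\<lambda>p. neg_part (F p + s * v p)) + ereal (s * signed_integral (J \<Otimes>\<^sub>M J) \<alpha> v)"
proof -
  have signed: "finite_signed_measure (J \<Otimes>\<^sub>M J) \<alpha>" using \<alpha> by (simp add: circulation_def)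
  have nonneg: "0 \<le> \<alpha> A" if "A \<in> sets (J \<Otimes>\<^sub>M J)" for A
    using bspec[OF between that] measure_nonneg[of \<phi> A] by linarith
  obtain M where M: "sets M = sets (J \<Otimes>\<^sub>M J)" "finite_measure M"
    "\<forall>A\<in>sets (J \<Otimes>\<^sub>M J). measure M A = \<alpha> A"
    using nonneg_signed_measure_obtains_measure[OF signed nonneg] by metis
  interpret finite_measure M by fact
  interpret balanced_measure M J
  proof
    fix A assume A: "A \<in> sets J"
    then have "measure M (A \<times> space J) = \<alpha> (A \<times> space J)" "measure M (space J \<times> A) = \<alpha> (space J \<times> A)"
      using M(3) by auto
    then show "measure M (A \<times> space J) = measure M (space J \<times> A)"
      using \<alpha> A by (simp add: circulation_def)
  qed (fact M)
  have le: "\<phi> \<le> M" "M \<le> \<psi>"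
    using between M sets finite by (simp_all add: le_measure_iff_measure_le)
  obtain b where "\<And>p. p \<in> space M \<Longrightarrow> \<bar>v p\<bar> \<le> b"
    using v(2) sets_eq_imp_space_eq[OF M(1)] by (auto simp: bounded_iff)
  then have "integrable M v"
    using v(1) by (intro integrable_const_bound[where B = b]) (auto simp: measurable_M)
  moreover have "integral\<^sup>L M v = signed_integral (J \<Otimes>\<^sub>M J) \<alpha> v"
    using M by (intro signed_integral_eq_integral[symmetric]) auto
  ultimately show ?thesis
    using potential_condition[OF le _ _ _ F, of "\<lambda>p. s * v p"] M(1) sets by simp
qed

text \<open>Potentials of bounded functions suffice here: their integrals are finite, and indicators
  among them already encode equality of marginals.\<close>

lemma potential_conditions_imp_circulation:
  fixes J :: "'a measure" and v :: "'a \<times> 'a \<Rightarrow> real" and \<phi> \<psi> :: "('a \<times> 'a) measure"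
  assumes v: "v \<in> borel_measurable (J \<Otimes>\<^sub>M J)" "bounded (v ` space (J \<Otimes>\<^sub>M J))"
    and sets: "sets \<phi> = sets (J \<Otimes>\<^sub>M J)" "sets \<psi> = sets (J \<Otimes>\<^sub>M J)"
    and finite: "finite_measure \<phi>" "finite_measure \<psi>"
    and le: "\<forall>A\<in>sets (J \<Otimes>\<^sub>M J). measure \<phi> A \<le> measure \<psi> A"
    and dual: "\<And>F s. potential J F \<Longrightarrow> s \<in> {1, -1, 0} \<Longrightarrow>
      ext_integral \<psi> (\<lambda>p. pos_part (F p + s * v p))
        \<ge> ext_integral \<phi> (\<lambda>p. neg_part (F p + s * v p)) + ereal (s * c)"
  obtains \<alpha> where "circulation J \<alpha>"
    "\<forall>A\<in>sets (J \<Otimes>\<^sub>M J). measure \<phi> A \<le> \<alpha> A \<and> \<alpha> A \<le> measure \<psi> A"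
    "signed_integral (J \<Otimes>\<^sub>M J) \<alpha> v = c"
proof -
  interpret phi: finite_measure \<phi> by fact
  interpret psi: finite_measure \<psi> by fact
  interpret measure_interval \<phi> \<psi>
    by unfold_locales (use sets le finite in \<open>simp_all add: le_measure_iff_measure_le\<close>)
  have space: "space \<psi> = space J \<times> space J"
    using sets_eq_imp_space_eq[OF sets(2)] by (simp add: space_pair_measure)
  have meas: "measurable \<psi> N = measurable (J \<Otimes>\<^sub>M J) N" for N :: "real measure"
    by (rule measurable_cong_sets[OF sets(2) refl])
  obtain b where b: "\<And>p. p \<in> space \<psi> \<Longrightarrow> \<bar>v p\<bar> \<le> b"
    using v(2) sets_eq_imp_space_eq[OF sets(2)] by (auto simp: bounded_iff)
  have int_v: "integrable \<psi> v"
    using v(1) b by (intro psi.integrable_const_bound[where B = b]) (auto simp: meas)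
  define V :: "('a \<Rightarrow> real) set"
    where "V = {f \<in> borel_measurable J. \<exists>B. \<forall>x\<in>space J. \<bar>f x\<bar> \<le> B}"
  define G where "G f s = (\<lambda>p. f (fst p) - f (snd p) + s * v p)" for f :: "'a \<Rightarrow> real" and s
  \<comment> \<open>Both components are linear in \<open>(f, s)\<close>, so \<open>W\<close> is a
    subspace. It demands at once that these potentials integrate to \<open>0\<close> and that
    \<open>v\<close> integrates to \<open>c\<close>.\<close>
  define W where "W = {(G f s, s * c) | f s. f \<in> V}"
  have V_lincomb: "(\<lambda>x. t * f x + g x) \<in> V" if "f \<in> V" "g \<in> V" for f g and t :: real
  proof -
    from that obtain B B' where B: "\<And>x. x \<in> space J \<Longrightarrow> \<bar>f x\<bar> \<le> B" "\<And>x. x \<in> space J \<Longrightarrow> \<bar>g x\<bar> \<le> B'"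
      by (auto simp: V_def)
    have "\<bar>t * f x + g x\<bar> \<le> \<bar>t\<bar> * B + B'" if "x \<in> space J" for x
    proof -
      have "\<bar>t * f x + g x\<bar> \<le> \<bar>t\<bar> * \<bar>f x\<bar> + \<bar>g x\<bar>"
        using abs_triangle_ineq[of "t * f x" "g x"] by (simp add: abs_mult)
      also have "\<dots> \<le> \<bar>t\<bar> * B + B'"
        using B[OF that] by (intro add_mono mult_left_mono) auto
      finally show ?thesis .
    qed
    with that show ?thesis by (auto simp: V_def)
  qed
  have V_zero: "(\<lambda>_. 0) \<in> V" by (auto simp: V_def)
  have int_diff: "integrable \<psi> (\<lambda>p. f (fst p) - f (snd p))" if "f \<in> V" for f :: "'a \<Rightarrow> real"
  proof -
    from that obtain B where B: "\<And>x. x \<in> space J \<Longrightarrow> \<bar>f x\<bar> \<le> B" and [measurable]: "f \<in> borel_measurable J"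
      by (auto simp: V_def)
    have "integrable \<psi> (\<lambda>p. f (fst p))" "integrable \<psi> (\<lambda>p. f (snd p))"
      by (rule psi.integrable_const_bound[where B = B]; use B in \<open>auto simp: meas space\<close>)+
    then show ?thesis by simp
  qed
  have int_G: "integrable \<psi> (G f s)" if "f \<in> V" for f s
    unfolding G_def using int_diff[OF that] int_v by simp
  have dual_unit: "(\<integral>p. max (- G f s p) 0 \<partial>\<phi>) + s * c \<le> (\<integral>p. max (G f s p) 0 \<partial>\<psi>)"
    if f: "f \<in> V" and s: "s \<in> {1, -1, 0}" for f s
  proof -
    have "potential J (\<lambda>p. f (fst p) - f (snd p))"
      using f by (auto simp: potential_def V_def)
    from dual[OF this s] have "ext_integral \<phi> (\<lambda>p. max (- G f s p) 0) + ereal (s * c)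
        \<le> ext_integral \<psi> (\<lambda>p. max (G f s p) 0)"
      by (simp add: pos_part_def neg_part_def G_def)
    then show ?thesis
      using int_G[OF f, of s] integrable_lower[OF int_G[OF f, of s]]
      by (simp add: ext_integral_eq_integral)
  qed
  have dual_W: "s * c \<le> (\<integral>p. max (G f s p) 0 \<partial>\<psi>) - (\<integral>p. max (- G f s p) 0 \<partial>\<phi>)" if f: "f \<in> V" for f s
  proof -
    \<comment> \<open>Both sides are positively homogeneous, so dividing by \<open>r\<close> reduces
      every \<open>s\<close> to its sign. The value \<open>1\<close> at \<open>s = 0\<close> keeps
      \<open>r\<close> positive.\<close>
    define r where "r = (if s = 0 then 1 else \<bar>s\<bar>)"
    have r: "r > 0" "r * sgn s = s" "sgn s \<in> {1, -1, 0}"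
      by (auto simp: r_def sgn_if)
    define g where "g = (\<lambda>x. (1 / r) * f x + 0)"
    have g: "g \<in> V" unfolding g_def using V_lincomb[OF f V_zero, of "1 / r"] .
    have "G f s p = r * G g (sgn s) p" for p
      using r(1,2) by (simp add: G_def g_def algebra_simps flip: mult.assoc)
    then have scale: "max (G f s p) 0 = r * max (G g (sgn s) p) 0"
      "max (- G f s p) 0 = r * max (- G g (sgn s) p) 0" for p
      using r(1) by (simp_all add: max_mult_distrib_left)
    have "r * ((\<integral>p. max (- G g (sgn s) p) 0 \<partial>\<phi>) + sgn s * c) \<le> r * (\<integral>p. max (G g (sgn s) p) 0 \<partial>\<psi>)"
      using dual_unit[OF g r(3)] r(1) by (intro mult_left_mono) auto
    moreover have "r * (sgn s * c) = s * c" using r(2) by (simp flip: mult.assoc)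
    ultimately show ?thesis by (simp add: scale distrib_left)
  qed
  obtain M where M: "sets M = sets \<psi>" "\<phi> \<le> M" "M \<le> \<psi>" "\<And>g d. (g, d) \<in> W \<Longrightarrow> integral\<^sup>L M g = d"
  proof (rule interpolating_measure[of W])
    have "(\<lambda>_. 0, 0) = (G (\<lambda>_. 0) 0, 0 * c)" by (simp add: G_def)
    then show "(\<lambda>_. 0, 0) \<in> W" using V_zero unfolding W_def by blast
  next
    fix f' c' g' d' and t :: real assume "(f', c') \<in> W" "(g', d') \<in> W"
    then obtain f s g s' where fg: "f \<in> V" "g \<in> V"
      and eq: "f' = G f s" "c' = s * c" "g' = G g s'" "d' = s' * c"
      by (auto simp: W_def)
    have "(\<lambda>x. t * f' x + g' x) = G (\<lambda>x. t * f x + g x) (t * s + s')"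
      by (simp add: eq G_def algebra_simps)
    moreover have "t * c' + d' = (t * s + s') * c" by (simp add: eq algebra_simps)
    ultimately show "(\<lambda>x. t * f' x + g' x, t * c' + d') \<in> W"
      using V_lincomb[OF fg, of t] unfolding W_def by blast
  next
    show "integrable \<psi> g" if "(g, d) \<in> W" for g d using that int_G by (auto simp: W_def)
    show "d \<le> (\<integral>x. max (g x) 0 \<partial>\<psi>) - (\<integral>x. max (- g x) 0 \<partial>\<phi>)" if "(g, d) \<in> W" for g d
      using that dual_W by (auto simp: W_def)
  qed (rule that)
  have sets_M: "sets M = sets (J \<Otimes>\<^sub>M J)" using M(1) sets(2) by simp
  have space_M: "space M = space J \<times> space J"
    using sets_eq_imp_space_eq[OF M(1)] space by simp
  have fin_M: "finite_measure M"
    using le_measureD3[OF M(3) M(1), of "space \<psi>"] sets_eq_imp_space_eq[OF M(1)] psi.emeasure_finite[of "space \<psi>"]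
    by (intro finite_measureI) (auto simp: top_unique)
  interpret M: finite_measure M by fact
  have "measure M (A \<times> space J) = measure M (space J \<times> A)" if A: "A \<in> sets J" for A
  proof -
    \<comment> \<open>The constraint for the indicator of \<open>A\<close> with \<open>s = 0\<close>
      is exactly the circulation equation at \<open>A\<close>.\<close>
    have "indicator A \<in> V" using A by (auto simp: V_def intro!: exI[of _ 1] simp: indicator_def)
    then have "(G (indicator A) 0, 0 * c) \<in> W" unfolding W_def by blast
    then have "0 = integral\<^sup>L M (G (indicator A) 0)" using M(4) by simp
    also have "\<dots> = (\<integral>p. indicator (A \<times> space J) p - indicator (space J \<times> A) p \<partial>M)"
      by (rule Bochner_Integration.integral_cong) (auto simp: G_def indicator_def space_M)
    also have "\<dots> = measure M (A \<times> space J) - measure M (space J \<times> A)"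
    proof -
      have "A \<times> space J \<in> sets M" "space J \<times> A \<in> sets M" using A sets_M by auto
      then show ?thesis by (simp add: M.emeasure_finite less_top[symmetric])
    qed
    finally show ?thesis by simp
  qed
  then have "circulation J (measure M)"
    using finite_signed_measure_measure[OF fin_M sets_M] by (simp add: circulation_def)
  moreover have "measure \<phi> A \<le> measure M A \<and> measure M A \<le> measure \<psi> A"
    if "A \<in> sets (J \<Otimes>\<^sub>M J)" for A
    using M(1-3) that sets by (simp add: le_measure_iff_measure_le finite fin_M)
  moreover have "signed_integral (J \<Otimes>\<^sub>M J) (measure M) v = c"
  proof -
    \<comment> \<open>With the zero potential and \<open>s = 1\<close> the constraint fixes the
      integral of \<open>v\<close>.\<close>
    have "(G (\<lambda>_. 0) 1, 1 * c) \<in> W" using V_zero unfolding W_def by blast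
    then have "integral\<^sup>L M v = c" using M(4) by (simp add: G_def)
    then show ?thesis using signed_integral_eq_integral[OF fin_M sets_M, of "measure M" v] by simp
  qed
  ultimately show thesis by (intro that) auto
qed

theorem theorem4p6:
  fixes J :: "'a measure"
    and v :: "'a \<times> 'a \<Rightarrow> real"
    and c :: real
    and \<phi> \<psi> :: "('a \<times> 'a) measure"
  assumes "standard_borel J"
    and "v \<in> borel_measurable (J \<Otimes>\<^sub>M J)"
    and "\<forall>p\<in>space (J \<Otimes>\<^sub>M J). 0 \<le> v p"
    and "bounded (v ` space (J \<Otimes>\<^sub>M J))"
    and "sets \<phi> = sets (J \<Otimes>\<^sub>M J)" and "finite_measure \<phi>"
    and "sets \<psi> = sets (J \<Otimes>\<^sub>M J)" and "finite_measure \<psi>"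
    and "\<forall>A\<in>sets (J \<Otimes>\<^sub>M J). measure \<phi> A \<le> measure \<psi> A"
  shows "(\<exists>\<alpha>. circulation J \<alpha> \<and>
            (\<forall>A\<in>sets (J \<Otimes>\<^sub>M J). measure \<phi> A \<le> \<alpha> A \<and> \<alpha> A \<le> measure \<psi> A) \<and>
            signed_integral (J \<Otimes>\<^sub>M J) \<alpha> v = c)
     \<longleftrightarrow>
         (\<forall>F. potential J F \<longrightarrow>
            ext_integral \<psi> (\<lambda>p. pos_part (F p + v p))
              \<ge> ext_integral \<phi> (\<lambda>p. neg_part (F p + v p)) + ereal c \<and>
            ext_integral \<psi> (\<lambda>p. pos_part (F p - v p))
              \<ge> ext_integral \<phi> (\<lambda>p. neg_part (F p - v p)) - ereal c \<and>
            ext_integral \<psi> (\<lambda>p. pos_part (F p))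
              \<ge> ext_integral \<phi> (\<lambda>p. neg_part (F p)))"
    (is "?circ \<longleftrightarrow> ?dual")
proof
  assume ?circ
  then obtain \<alpha> where \<alpha>: "circulation J \<alpha>"
      "\<forall>A\<in>sets (J \<Otimes>\<^sub>M J). measure \<phi> A \<le> \<alpha> A \<and> \<alpha> A \<le> measure \<psi> A"
    and c: "signed_integral (J \<Otimes>\<^sub>M J) \<alpha> v = c"
    by blast
  \<comment> \<open>The values \<open>1\<close>, \<open>-1\<close> and \<open>0\<close> of the
    factor \<open>s\<close> yield the three conditions in turn.\<close>
  note cond = circulation_imp_potential_conditions[OF assms(2,4,5,7,6,8) \<alpha>, unfolded c]
  show ?dual
  proof (intro allI impI conjI)
    fix F assume F: "potential J F"
    show "ext_integral \<psi> (\<lambda>p. pos_part (F p + v p))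
        \<ge> ext_integral \<phi> (\<lambda>p. neg_part (F p + v p)) + ereal c"
      using cond[OF F, of 1] by simp
    show "ext_integral \<psi> (\<lambda>p. pos_part (F p - v p))
        \<ge> ext_integral \<phi> (\<lambda>p. neg_part (F p - v p)) - ereal c"
      using cond[OF F, of "-1"] by (simp add: minus_ereal_def)
    show "ext_integral \<psi> (\<lambda>p. pos_part (F p)) \<ge> ext_integral \<phi> (\<lambda>p. neg_part (F p))"
      using cond[OF F, of 0] by (simp flip: zero_ereal_def)
  qed
next
  assume dual: ?dual
  have "ext_integral \<psi> (\<lambda>p. pos_part (F p + s * v p))
      \<ge> ext_integral \<phi> (\<lambda>p. neg_part (F p + s * v p)) + ereal (s * c)"
    if F: "potential J F" and s: "s \<in> {1, -1, 0}" for F s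
    using s dual[rule_format, OF F] by (auto simp: minus_ereal_def simp flip: zero_ereal_def)
  then obtain \<alpha> where "circulation J \<alpha>"
    "\<forall>A\<in>sets (J \<Otimes>\<^sub>M J). measure \<phi> A \<le> \<alpha> A \<and> \<alpha> A \<le> measure \<psi> A"
    "signed_integral (J \<Otimes>\<^sub>M J) \<alpha> v = c"
    using potential_conditions_imp_circulation[OF assms(2,4,5,7,6,8) assms(9)] by blast
  then show ?circ by blast
qed

end
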